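(* Let $X$ be a proper metric space and let $\mathcal{A}=\{A_1,\dots,A_n\}\subset H(X)$ be a nonempty finite set. Then $\Sigma(\mathcal{A})$ and $\Omega(\mathcal{A})$ are not empty, and for any $d\in\Omega(\mathcal{A})$ the set $\Sigma_d(\mathcal{A})$ contains a unique maximal Steiner compact, and this Steiner compact is equal to $K_d(\mathcal{A})$.
   Context: A metric space is proper if every closed bounded subset of it is compact. For a metric space $(X,\rho)$, $H(X)$ denotes the set of all nonempty compact subsets of $X$ endowed with the Hausdorff distance $d_H$. For $A\subset X$ and $r\ge 0$, $B_r^X(A)=\{x\in X:\rho(x,A)\le r\}$, where $\rho(x,A)=\inf_{a\in A}\rho(x,a)$. For $\mathcal{A}=\{A_1,\dots,A_n\}\subset H(X)$ and $K\in H(X)$ put $S_{\mathcal{A}}(K)=\sum_{i=1}^n d_H(K,A_i)$. $\Sigma(\mathcal{A})$ is the set of all $K\in H(X)$ at which $S_{\mathcal{A}}$ attains its minimum over $H(X)$; its elements are called Steiner compacts. $\Omega(\mathcal{A})=\{(d_H(K,A_1),\dots,d_H(K,A_n)):K\in\Sigma(\mathcal{A})\}$, and for $d=(d_1,\dots,d_n)\in\Omega(\mathcal{A})$, $\Sigma_d(\mathcal{A})=\{K\in\Sigma(\mathcal{A}): d_H(K,A_i)=d_i \text{ for all } i\}$. A maximal Steiner compact in $\Sigma_d(\mathcal{A})$ is a maximal element of $\Sigma_d(\mathcal{A})$ with respect to inclusion. For a vector $d=(d_1,\dots,d_n)$ with nonnegative components, $K_d(\mathcal{A})=\bigcap_{i=1}^n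 B_{d_i}^X(A_i)$. *)

theory Defs
  imports "HOL-Analysis.Analysis"
begin

definition hyperspace :: "'a::metric_space set set"
  where "hyperspace = {K. K \<noteq> {} \<and> compact K}"

definition closed_nbhd :: "real \<Rightarrow> 'a::metric_space set \<Rightarrow> 'a set"
  where "closed_nbhd r A = {x. infdist x A \<le> r}"

definition hausdorff_dist :: "'a::metric_space set \<Rightarrow> 'a set \<Rightarrow> real"
  where "hausdorff_dist A B = Inf {r. 0 \<le> r \<and> A \<subseteq> closed_nbhd r B \<and> B \<subseteq> closed_nbhd r A}"

(* Agreement with the other common definition of the Hausdorff distance. *)
lemma hausdorff_dist_eq_max_SUP:
  assumes "A \<in> hyperspace" "B \<in> hyperspace"
  shows "hausdorff_dist A B = max (SUP a\<in>A. infdist a B) (SUP b\<in>B. infdist b A)"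
proof -
  have ne: "A \<noteq> {}" "B \<noteq> {}" and co: "compact A" "compact B"
    using assms by (auto simp: hyperspace_def)
  have bdd: "bdd_above ((\<lambda>x. infdist x T) ` S)" if "compact S" for S T :: "'a set"
    by (intro bounded_imp_bdd_above compact_imp_bounded compact_continuous_image
        continuous_intros that)
  have le: "(SUP x\<in>S. infdist x T) \<le> r \<longleftrightarrow> S \<subseteq> closed_nbhd r T"
    if "S \<noteq> {}" "compact S" for S T :: "'a set" and r
    using cSUP_le_iff[OF that(1) bdd[OF that(2)]] by (auto simp: closed_nbhd_def)
  define M where "M = max (SUP a\<in>A. infdist a B) (SUP b\<in>B. infdist b A)"
  obtain a where "a \<in> A" using ne by blast
  then have "0 \<le> (SUP a\<in>A. infdist a B)"
    by (rule cSUP_upper2[OF bdd[OF co(1)] _ infdist_nonneg])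
  then have "0 \<le> M" by (simp add: M_def)
  then have "{r. 0 \<le> r \<and> A \<subseteq> closed_nbhd r B \<and> B \<subseteq> closed_nbhd r A} = {M..}"
    unfolding le[OF ne(1) co(1), of B, symmetric] le[OF ne(2) co(2), of A, symmetric]
    by (auto simp: M_def)
  then show ?thesis
    by (simp add: hausdorff_dist_def M_def)
qed

(* A family A_1, ..., A_n is a list As and a vector (d_1, ..., d_n) is a list of reals,
   with position i < n of the list holding the entry of index i + 1. *)

definition steiner_sum :: "'a::metric_space set list \<Rightarrow> 'a set \<Rightarrow> real"
  where "steiner_sum As K = (\<Sum>i<length As. hausdorff_dist K (As ! i))"

definition steiner_compacts :: "'a::metric_space set list \<Rightarrow> 'a set set"
  where "steiner_compacts As = {K. is_arg_min (steiner_sum As) (\<lambda>L. L \<in> hyperspace) K}"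

definition dist_vectors :: "'a::metric_space set list \<Rightarrow> real list set"
  where "dist_vectors As = (\<lambda>K. map (hausdorff_dist K) As) ` steiner_compacts As"

definition steiner_compacts_at :: "'a::metric_space set list \<Rightarrow> real list \<Rightarrow> 'a set set"
  where "steiner_compacts_at As d =
    {K \<in> steiner_compacts As. \<forall>i<length As. hausdorff_dist K (As ! i) = d ! i}"

definition maximal_steiner_compact :: "'a::metric_space set list \<Rightarrow> real list \<Rightarrow> 'a set \<Rightarrow> bool"
  where "maximal_steiner_compact As d K \<longleftrightarrow>
    K \<in> steiner_compacts_at As d \<and> (\<forall>L\<in>steiner_compacts_at As d. K \<subseteq> L \<longrightarrow> L = K)"

definition nbhd_Inter :: "'a::metric_space set list \<Rightarrow> real list \<Rightarrow> 'a set"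
  where "nbhd_Inter As d = (\<Inter>i<length As. closed_nbhd (d ! i) (As ! i))"

end

theory Submission
  imports Defs
begin

text \<open>
  Write $d_H$ for the Hausdorff distance.  The intersection of closed neighbourhoods
  $K_d = \bigcap_i B_{d_i}(A_i)$ contains every \<open>K \<in> H(X)\<close> with $d_H(K, A_i) \le d_i$ for
  all \<open>i\<close>.  Enlarging \<open>K\<close> to $K_d$ does not spoil these bounds: the points of $K_d$ are close to
  each $A_i$ by construction, and the points of $A_i$ are already close to \<open>K\<close>.  So if \<open>d\<close> is the
  vector of distances of a Steiner compact, then $d_H(K_d, A_i) \le d_i$ for all \<open>i\<close>; as the sum
  of the $d_i$ is minimal, all these inequalities are equalities.  Hence $K_d$ is the greatest
  element of $\Sigma_d$, and therefore its only maximal one.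

  Existence of a minimizer follows from the same construction, without compactness of the
  hyperspace.  Along a minimizing sequence $K^k$ the distance vectors are bounded, so after
  passing to a subsequence they converge to some \<open>d\<close> whose entries add up to the infimum.  The
  sets $K^k$ themselves need not be made to converge, because $K_d$ serves as a minimizer: a
  point \<open>a\<close> of $A_i$ has some $x_k \in K^k$ within distance $d_H(K^k, A_i)$, and in a proper
  space the $x_k$ accumulate at a point of $K_d$ within distance $d_i$ of \<open>a\<close>.  Both uses are instances of the
  lemma \<open>nbhd_Inter_of_limit\<close>, the first one for a constant sequence.
\<close>

section \<open>Closed neighbourhoods and the Hausdorff distance\<close>

lemma closed_nbhd_iff:
  assumes "A \<in> hyperspace"
  shows "x \<in> closed_nbhd r A \<longleftrightarrow> (\<exists>a\<in>A. dist x a \<le> r)"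
proof
  assume "x \<in> closed_nbhd r A"
  moreover obtain a where a: "a \<in> A" "\<And>b. b \<in> A \<Longrightarrow> dist x a \<le> dist x b"
  proof -
    have "continuous_on A (dist x)"
      by (intro continuous_intros)
    then show ?thesis
      using assms continuous_attains_inf[of A "dist x"] that by (auto simp: hyperspace_def)
  qed
  moreover have "dist x a \<le> infdist x A"
    using a by (subst infdist_notempty) (auto intro: cINF_greatest)
  ultimately show "\<exists>a\<in>A. dist x a \<le> r"
    by (force simp: closed_nbhd_def)
next
  assume "\<exists>a\<in>A. dist x a \<le> r"
  then show "x \<in> closed_nbhd r A"
    by (auto simp: closed_nbhd_def intro: infdist_le2)
qed

text \<open>The infimum that defines the Hausdorff distance is attained.\<close>

lemma hausdorff_dist_le_iff:
  assumes A: "A \<in> hyperspace" and B: "B \<in> hyperspace"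
  shows "hausdorff_dist A B \<le> r \<longleftrightarrow> A \<subseteq> closed_nbhd r B \<and> B \<subseteq> closed_nbhd r A"
proof -
  have "(SUP x\<in>S. infdist x T) \<le> r \<longleftrightarrow> S \<subseteq> closed_nbhd r T" if "S \<in> hyperspace" for S T :: "'a set"
  proof -
    have S: "S \<noteq> {}" "compact S"
      using that by (auto simp: hyperspace_def)
    have "bdd_above ((\<lambda>x. infdist x T) ` S)"
      by (intro bounded_imp_bdd_above compact_imp_bounded compact_continuous_image
          continuous_intros S)
    then show ?thesis
      using cSUP_le_iff[OF S(1)] by (auto simp: closed_nbhd_def)
  qed
  then show ?thesis
    using A B by (simp add: hausdorff_dist_eq_max_SUP)
qed

lemma hausdorff_dist_nonneg:
  assumes "A \<in> hyperspace" "B \<in> hyperspace"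
  shows "0 \<le> hausdorff_dist A B"
proof -
  obtain a where "a \<in> A"
    using assms by (auto simp: hyperspace_def)
  then have "a \<in> closed_nbhd (hausdorff_dist A B) B"
    using hausdorff_dist_le_iff[OF assms] by blast
  then show ?thesis
    using infdist_nonneg[of a B] by (simp add: closed_nbhd_def)
qed

lemma closed_closed_nbhd: "closed (closed_nbhd r A)"
  unfolding closed_nbhd_def by (intro closed_Collect_le continuous_intros)

lemma bounded_closed_nbhd:
  assumes "A \<in> hyperspace"
  shows "bounded (closed_nbhd r A)"
proof -
  have "bounded A"
    using assms compact_imp_bounded by (auto simp: hyperspace_def)
  then obtain c e where e: "\<And>a. a \<in> A \<Longrightarrow> dist c a \<le> e"
    unfolding bounded_def by metis
  have "\<forall>x\<in>closed_nbhd r A. dist c x \<le> e + r"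
  proof
    fix x assume "x \<in> closed_nbhd r A"
    then obtain a where "a \<in> A" "dist x a \<le> r"
      using closed_nbhd_iff[OF assms, of x r] by blast
    then show "dist c x \<le> e + r"
      using e[of a] dist_triangle[of c x a] by (simp add: dist_commute)
  qed
  then show ?thesis
    unfolding bounded_def by blast
qed

section \<open>The intersection of closed neighbourhoods\<close>

lemma compact_nbhd_Inter:
  fixes As :: "'a::metric_space set list"
  assumes proper: "\<forall>S::'a set. closed S \<and> bounded S \<longrightarrow> compact S"
    and "As \<noteq> []" and "set As \<subseteq> hyperspace"
  shows "compact (nbhd_Inter As d)"
proof -
  have "As ! 0 \<in> hyperspace" "nbhd_Inter As d \<subseteq> closed_nbhd (d ! 0) (As ! 0)"
    using assms by (auto simp: nbhd_Inter_def)
  then have "bounded (nbhd_Inter As d)"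
    using bounded_closed_nbhd bounded_subset by blast
  moreover have "closed (nbhd_Inter As d)"
    unfolding nbhd_Inter_def by (intro closed_INT ballI closed_closed_nbhd)
  ultimately show ?thesis
    using proper by blast
qed

text \<open>
  This replaces the compactness of bounded sets in the hyperspace: only the distance vectors are
  assumed to converge, not the compact sets.  The inclusion of $K_d$ in the neighbourhoods of the
  $A_i$ holds by construction; the reverse closeness, and with it $K_d \ne \emptyset$,
  comes from accumulation points of nearby points of the \<open>K k\<close>.
\<close>

lemma nbhd_Inter_of_limit:
  fixes As :: "'a::metric_space set list"
  assumes proper: "\<forall>S::'a set. closed S \<and> bounded S \<longrightarrow> compact S"
    and ne: "As \<noteq> []" and As: "set As \<subseteq> hyperspace"
    and K: "\<And>k. K k \<in> hyperspace"
    and lim: "\<And>i. i < length As \<Longrightarrow> (\<lambda>k. hausdorff_dist (K k) (As ! i)) \<longlonglongrightarrow> d ! i"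
  shows "nbhd_Inter As d \<in> hyperspace"
    and "i < length As \<Longrightarrow> hausdorff_dist (nbhd_Inter As d) (As ! i) \<le> d ! i"
proof -
  define h where "h = (\<lambda>i k. hausdorff_dist (K k) (As ! i))"
  have Asi: "As ! i \<in> hyperspace" if "i < length As" for i
    using As that by auto
  have h: "K k \<subseteq> closed_nbhd (h i k) (As ! i)" "As ! i \<subseteq> closed_nbhd (h i k) (K k)"
    if "i < length As" for i k
    using hausdorff_dist_le_iff[OF K Asi[OF that], of k "h i k"] by (simp_all add: h_def)
  \<comment> \<open>For \<open>j \<noteq> i\<close> too, the limit point stays in the neighbourhood of \<open>As ! j\<close>, as \<open>K k\<close> does.\<close>
  have near: "\<exists>x\<in>nbhd_Inter As d. dist a x \<le> d ! i" if i: "i < length As" and a: "a \<in> As ! i" for i a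
  proof -
    have "\<exists>x. x \<in> K k \<and> dist a x \<le> h i k" for k
      using h(2)[OF i] a closed_nbhd_iff[OF K] by blast
    then obtain x where x: "\<And>k. x k \<in> K k" "\<And>k. dist a (x k) \<le> h i k"
      by metis
    have "Bseq (h i)"
      unfolding h_def by (rule convergent_imp_Bseq[OF convergentI[OF lim[OF i]]])
    then obtain C where C: "\<And>k. \<bar>h i k\<bar> \<le> C"
      unfolding Bseq_def real_norm_def by blast
    have xC: "\<forall>k. x k \<in> cball a C"
      using order_trans[OF x(2) abs_le_D1[OF C]] by simp
    have "compact (cball a C)"
      using proper by simp
    then have "seq_compact (cball a C)"
      by (rule compact_imp_seq_compact)
    then obtain l r where r: "strict_mono (r :: nat \<Rightarrow> nat)" and l: "(x \<circ> r) \<longlonglongrightarrow> l"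
      using xC by (rule seq_compactE)
    have hr: "(\<lambda>k. h j (r k)) \<longlonglongrightarrow> d ! j" if "j < length As" for j
      using LIMSEQ_subseq_LIMSEQ[OF lim[OF that] r] by (simp add: o_def h_def)
    have "infdist l (As ! j) \<le> d ! j" if j: "j < length As" for j
    proof (rule LIMSEQ_le[OF _ hr[OF j]])
      show "(\<lambda>k. infdist ((x \<circ> r) k) (As ! j)) \<longlonglongrightarrow> infdist l (As ! j)"
        by (rule tendsto_infdist[OF l])
      have "infdist (x k) (As ! j) \<le> h j k" for k
        using h(1)[OF j, of k] x(1)[of k] by (auto simp: closed_nbhd_def)
      then show "\<exists>N. \<forall>k\<ge>N. infdist ((x \<circ> r) k) (As ! j) \<le> h j (r k)"
        by simp
    qed
    then have "l \<in> nbhd_Inter As d"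
      by (auto simp: nbhd_Inter_def closed_nbhd_def)
    moreover have "dist a l \<le> d ! i"
    proof (rule LIMSEQ_le[OF _ hr[OF i]])
      show "(\<lambda>k. dist a ((x \<circ> r) k)) \<longlonglongrightarrow> dist a l"
        by (rule tendsto_dist[OF tendsto_const l])
    qed (use x(2) in auto)
    ultimately show ?thesis by blast
  qed
  have "As ! 0 \<noteq> {}"
    using Asi[of 0] ne by (auto simp: hyperspace_def)
  then have "nbhd_Inter As d \<noteq> {}"
    using near[of 0] ne by auto
  then show H: "nbhd_Inter As d \<in> hyperspace"
    using compact_nbhd_Inter[OF proper ne As] by (simp add: hyperspace_def)
  show "hausdorff_dist (nbhd_Inter As d) (As ! i) \<le> d ! i" if i: "i < length As"
  proof -
    have "nbhd_Inter As d \<subseteq> closed_nbhd (d ! i) (As ! i)"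
      using i by (auto simp: nbhd_Inter_def)
    moreover have "As ! i \<subseteq> closed_nbhd (d ! i) (nbhd_Inter As d)"
      using near[OF i] closed_nbhd_iff[OF H] by blast
    ultimately show ?thesis
      using hausdorff_dist_le_iff[OF H Asi[OF i]] by blast
  qed
qed

section \<open>Existence of Steiner compacts\<close>

lemma bounded_family_convergent_subsequence:
  fixes f :: "'i \<Rightarrow> nat \<Rightarrow> real"
  assumes "finite I" and "\<And>i. i \<in> I \<Longrightarrow> Bseq (f i)"
  shows "\<exists>r::nat \<Rightarrow> nat. strict_mono r \<and> (\<forall>i\<in>I. convergent (f i \<circ> r))"
  using assms
proof (induction I)
  case empty
  then show ?case using strict_mono_id by blast
next
  case (insert i I)
  have "\<exists>r::nat \<Rightarrow> nat. strict_mono r \<and> (\<forall>j\<in>I. convergent (f j \<circ> r))"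
    by (rule insert.IH) (simp add: insert.prems)
  then obtain r :: "nat \<Rightarrow> nat" where r: "strict_mono r" "\<forall>j\<in>I. convergent (f j \<circ> r)"
    by blast
  have "bounded (range (f i \<circ> r))"
    by (rule bounded_subset[of "range (f i)"]) (use insert.prems[of i] Bseq_eq_bounded in auto)
  then obtain l s where s: "strict_mono (s :: nat \<Rightarrow> nat)" and "((f i \<circ> r) \<circ> s) \<longlonglongrightarrow> l"
    using bounded_imp_convergent_subsequence by blast
  then have "convergent (f i \<circ> (r \<circ> s))"
    unfolding o_assoc by (intro convergentI)
  moreover have "convergent (f j \<circ> (r \<circ> s))" if "j \<in> I" for j
    unfolding o_assoc using convergent_subseq_convergent[OF bspec[OF r(2) that] s] .
  ultimately show ?case
    using strict_mono_o[OF r(1) s] by blast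
qed

theorem steiner_compacts_nonempty:
  fixes As :: "'a::metric_space set list"
  assumes proper: "\<forall>S::'a set. closed S \<and> bounded S \<longrightarrow> compact S"
    and ne: "As \<noteq> []" and As: "set As \<subseteq> hyperspace"
  shows "steiner_compacts As \<noteq> {}"
proof -
  define n where "n = length As"
  define m where "m = Inf (steiner_sum As ` hyperspace)"
  have Asi: "As ! i \<in> hyperspace" if "i < n" for i
    using As that by (auto simp: n_def)
  have nonneg: "0 \<le> hausdorff_dist K (As ! i)" if "K \<in> hyperspace" "i < n" for K i
    using that Asi hausdorff_dist_nonneg by blast
  have "0 \<le> steiner_sum As K" if "K \<in> hyperspace" for K
    unfolding steiner_sum_def using that nonneg by (intro sum_nonneg) (auto simp: n_def)
  then have bdd: "bdd_below (steiner_sum As ` hyperspace)"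
    by (intro bdd_belowI[of _ 0]) auto
  have hne: "steiner_sum As ` hyperspace \<noteq> {}"
    using Asi[of 0] ne by (auto simp: n_def)
  have m_le: "m \<le> steiner_sum As K" if "K \<in> hyperspace" for K
    unfolding m_def using bdd that by (intro cInf_lower) auto
  have "\<exists>K. K \<in> hyperspace \<and> steiner_sum As K < m + 1 / real (Suc k)" for k
    using cInf_lessD[OF hne, of "m + 1 / real (Suc k)"] by (auto simp: m_def)
  then obtain K where K: "\<And>k. K k \<in> hyperspace"
      "\<And>k. steiner_sum As (K k) < m + 1 / real (Suc k)"
    by metis
  define f where "f = (\<lambda>i k. hausdorff_dist (K k) (As ! i))"
  have sum_f: "steiner_sum As (K k) = (\<Sum>i<n. f i k)" for k
    by (simp add: steiner_sum_def f_def n_def)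
  have f_nonneg: "0 \<le> f i k" if "i < n" for i k
    using nonneg[OF K(1) that] by (simp add: f_def)
  have "Bseq (f i)" if i: "i \<in> {..<n}" for i
  proof (rule BseqI')
    fix k
    have "f i k \<le> (\<Sum>j<n. f j k)"
      using i by (intro member_le_sum) (auto intro: f_nonneg)
    also have "\<dots> \<le> m + 1 / real (Suc k)"
      using K(2)[of k] by (simp add: sum_f)
    also have "\<dots> \<le> m + 1"
      by simp
    finally show "norm (f i k) \<le> m + 1"
      using f_nonneg i by simp
  qed
  then obtain r :: "nat \<Rightarrow> nat" where r: "strict_mono r" "\<forall>i\<in>{..<n}. convergent (f i \<circ> r)"
    using bounded_family_convergent_subsequence[of "{..<n}" f] by blast
  define d where "d = map (\<lambda>i. lim (f i \<circ> r)) [0..<n]"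
  have lim: "(\<lambda>k. f i (r k)) \<longlonglongrightarrow> d ! i" if "i < n" for i
    using r(2) that by (auto simp: d_def convergent_LIMSEQ_iff o_def)
  have sum_d: "(\<Sum>i<n. d ! i) \<le> m"
  proof (rule LIMSEQ_le)
    show "(\<lambda>k. \<Sum>i<n. f i (r k)) \<longlonglongrightarrow> (\<Sum>i<n. d ! i)"
      by (intro tendsto_sum lim) simp
    have "(\<lambda>k. m + 1 / real (Suc k)) \<longlonglongrightarrow> m + 0"
      by (intro tendsto_add tendsto_const LIMSEQ_Suc[OF lim_1_over_n])
    from LIMSEQ_subseq_LIMSEQ[OF this r(1)]
    show "(\<lambda>k. m + 1 / real (Suc (r k))) \<longlonglongrightarrow> m"
      by (simp add: o_def)
    show "\<exists>N. \<forall>k\<ge>N. (\<Sum>i<n. f i (r k)) \<le> m + 1 / real (Suc (r k))"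
      using K(2) by (auto simp: sum_f intro: less_imp_le)
  qed
  have H: "nbhd_Inter As d \<in> hyperspace"
      "\<And>i. i < n \<Longrightarrow> hausdorff_dist (nbhd_Inter As d) (As ! i) \<le> d ! i"
    using nbhd_Inter_of_limit[OF proper ne As, of "\<lambda>k. K (r k)" d] K(1) lim
    by (auto simp: f_def n_def)
  have "steiner_sum As (nbhd_Inter As d) \<le> (\<Sum>i<n. d ! i)"
    unfolding steiner_sum_def n_def[symmetric] by (intro sum_mono H(2)) simp
  also have "\<dots> \<le> m" by (rule sum_d)
  finally have "nbhd_Inter As d \<in> steiner_compacts As"
    using H(1) m_le by (fastforce simp: steiner_compacts_def is_arg_min_linorder)
  then show ?thesis by blast
qed

section \<open>The greatest Steiner compact with given distances\<close>

lemma steiner_compacts_at_subset_nbhd_Inter: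
  assumes "set As \<subseteq> hyperspace" and L: "L \<in> steiner_compacts_at As d"
  shows "L \<subseteq> nbhd_Inter As d"
proof -
  have "L \<in> hyperspace"
    using L by (auto simp: steiner_compacts_at_def steiner_compacts_def is_arg_min_def)
  then have "L \<subseteq> closed_nbhd (d ! i) (As ! i)" if "i < length As" for i
    using L assms(1) that hausdorff_dist_le_iff[of L "As ! i" "d ! i"] nth_mem[OF that]
    by (simp add: steiner_compacts_at_def subset_eq)
  then show ?thesis
    by (auto simp: nbhd_Inter_def)
qed

text \<open>
  Each distance of $K_d$ is at most the corresponding entry of \<open>d\<close>; a strict inequality at one
  index would make the sum smaller than the minimum.
\<close>

lemma nbhd_Inter_in_steiner_compacts_at:
  fixes As :: "'a::metric_space set list"
  assumes proper: "\<forall>S::'a set. closed S \<and> bounded S \<longrightarrow> compact S"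
    and ne: "As \<noteq> []" and As: "set As \<subseteq> hyperspace"
    and K: "K \<in> steiner_compacts_at As d"
  shows "nbhd_Inter As d \<in> steiner_compacts_at As d"
proof -
  let ?M = "nbhd_Inter As d"
  have Kh: "K \<in> hyperspace" and min: "\<And>L. L \<in> hyperspace \<Longrightarrow> steiner_sum As K \<le> steiner_sum As L"
    and Kd: "\<And>i. i < length As \<Longrightarrow> hausdorff_dist K (As ! i) = d ! i"
    using K by (auto simp: steiner_compacts_at_def steiner_compacts_def is_arg_min_linorder)
  have M: "?M \<in> hyperspace" and le: "\<And>i. i < length As \<Longrightarrow> hausdorff_dist ?M (As ! i) \<le> d ! i"
    using nbhd_Inter_of_limit[OF proper ne As, of "\<lambda>_. K" d] Kh Kd by auto
  have sum_d: "steiner_sum As K = (\<Sum>i<length As. d ! i)"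
    using Kd by (simp add: steiner_sum_def)
  have sum_le: "steiner_sum As ?M \<le> steiner_sum As K"
    unfolding sum_d unfolding steiner_sum_def by (intro sum_mono le) simp
  have "hausdorff_dist ?M (As ! i) = d ! i" if "i < length As" for i
  proof (rule sum_mono_inv[where f = "\<lambda>i. hausdorff_dist ?M (As ! i)" and I = "{..<length As}"])
    show "(\<Sum>i<length As. hausdorff_dist ?M (As ! i)) = (\<Sum>i<length As. d ! i)"
      using sum_le min[OF M] sum_d by (simp add: steiner_sum_def)
  qed (use le that in auto)
  moreover have "?M \<in> steiner_compacts As"
    using M sum_le min by (fastforce simp: steiner_compacts_def is_arg_min_linorder)
  ultimately show ?thesis
    by (simp add: steiner_compacts_at_def)
qed

theorem mainTheorem4:
  fixes As :: "'a::metric_space set list"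
  assumes proper: "\<forall>S::'a set. closed S \<and> bounded S \<longrightarrow> compact S"
    and "As \<noteq> []"
    and "set As \<subseteq> hyperspace"
  shows "steiner_compacts As \<noteq> {} \<and> dist_vectors As \<noteq> {} \<and>
    (\<forall>d\<in>dist_vectors As.
      (\<exists>!K. maximal_steiner_compact As d K) \<and>
      maximal_steiner_compact As d (nbhd_Inter As d))"
proof (intro conjI ballI)
  show ne: "steiner_compacts As \<noteq> {}"
    by (rule steiner_compacts_nonempty[OF assms])
  show "dist_vectors As \<noteq> {}"
    using ne by (simp add: dist_vectors_def)
next
  fix d assume "d \<in> dist_vectors As"
  then obtain K where "K \<in> steiner_compacts As" "d = map (hausdorff_dist K) As"
    by (auto simp: dist_vectors_def)
  then have "K \<in> steiner_compacts_at As d"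
    by (simp add: steiner_compacts_at_def)
  then have M: "nbhd_Inter As d \<in> steiner_compacts_at As d"
    by (rule nbhd_Inter_in_steiner_compacts_at[OF assms])
  have greatest: "L \<subseteq> nbhd_Inter As d" if "L \<in> steiner_compacts_at As d" for L
    by (rule steiner_compacts_at_subset_nbhd_Inter[OF assms(3) that])
  show max: "maximal_steiner_compact As d (nbhd_Inter As d)"
    using M greatest by (auto simp: maximal_steiner_compact_def)
  show "\<exists>!K. maximal_steiner_compact As d K"
    using max M greatest by (metis maximal_steiner_compact_def)
qed

end
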